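(* Every Noetherian Banach algebra over a nonarchimedean field is a Jacobson ring, i.e. each of its prime ideals is an intersection of maximal ideals.
   Context: All rings are commutative with $1$. A nonarchimedean field $K$ is a field complete with respect to a nontrivial nonarchimedean absolute value. A Banach algebra over $K$ is a $K$-algebra $A$ complete with respect to a norm $\lVert\cdot\rVert$ satisfying $\lVert 1\rVert=1$, $\lVert f+g\rVert\leq\max(\lVert f\rVert,\lVert g\rVert)$, $\lVert fg\rVert\leq\lVert f\rVert\lVert g\rVert$ and $\lVert\lambda f\rVert=|\lambda|\lVert f\rVert$ for $\lambda\in K$, $f,g\in A$. It is Noetherian if its underlying ring is Noetherian. *)

theory Defs
  imports "HOL-Analysis.Abstract_Metric_Spaces" "HOL-Algebra.Module" "HOL-Algebra.Ring_Divisibility"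
begin

text \<open>The distance attached to a norm on the carrier of a ring. It is set to \<open>0\<close> outside the
  carrier because the locale \<^locale>\<open>Metric_space\<close> asks for nonnegativity and symmetry on the
  whole type; only its values on the carrier matter for completeness.\<close>

definition norm_dist :: "('a, 'm) ring_scheme \<Rightarrow> ('a \<Rightarrow> real) \<Rightarrow> 'a \<Rightarrow> 'a \<Rightarrow> real" where
  "norm_dist R N x y =
     (if x \<in> carrier R \<and> y \<in> carrier R then N (x \<ominus>\<^bsub>R\<^esub> y) else 0)"

definition norm_complete :: "('a, 'm) ring_scheme \<Rightarrow> ('a \<Rightarrow> real) \<Rightarrow> bool" where
  "norm_complete R N \<longleftrightarrow> Metric_space.mcomplete (carrier R) (norm_dist R N)"

locale nonarchimedean_field = Ring.field K for K (structure) +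
  fixes v :: "'a \<Rightarrow> real"
  assumes abs_nonneg: "x \<in> carrier K \<Longrightarrow> 0 \<le> v x"
    and abs_eq_0_iff: "x \<in> carrier K \<Longrightarrow> v x = 0 \<longleftrightarrow> x = \<zero>"
    and abs_mult: "\<lbrakk>x \<in> carrier K; y \<in> carrier K\<rbrakk> \<Longrightarrow> v (x \<otimes> y) = v x * v y"
    and abs_ultrametric: "\<lbrakk>x \<in> carrier K; y \<in> carrier K\<rbrakk> \<Longrightarrow> v (x \<oplus> y) \<le> max (v x) (v y)"
    and abs_nontrivial: "\<exists>x \<in> carrier K. x \<noteq> \<zero> \<and> v x \<noteq> 1"
    and abs_complete: "norm_complete K v"

locale nonarchimedean_banach_algebra =
  K: nonarchimedean_field K v + Module.algebra K A
  for K (structure) and v and A (structure) +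
  fixes N :: "'c \<Rightarrow> real"
  assumes norm_nonneg: "f \<in> carrier A \<Longrightarrow> 0 \<le> N f"
    and norm_eq_0_iff: "f \<in> carrier A \<Longrightarrow> N f = 0 \<longleftrightarrow> f = \<zero>\<^bsub>A\<^esub>"
    and norm_one: "N \<one>\<^bsub>A\<^esub> = 1"
    and norm_ultrametric:
      "\<lbrakk>f \<in> carrier A; g \<in> carrier A\<rbrakk> \<Longrightarrow> N (f \<oplus>\<^bsub>A\<^esub> g) \<le> max (N f) (N g)"
    and norm_mult_le:
      "\<lbrakk>f \<in> carrier A; g \<in> carrier A\<rbrakk> \<Longrightarrow> N (f \<otimes>\<^bsub>A\<^esub> g) \<le> N f * N g"
    and norm_smult:
      "\<lbrakk>c \<in> carrier K; f \<in> carrier A\<rbrakk> \<Longrightarrow> N (c \<odot>\<^bsub>A\<^esub> f) = v c * N f"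
    and complete: "norm_complete A N"

text \<open>The family \<open>S\<close> is required to be nonempty since \<open>\<Inter>{}\<close> is the whole type, not the
  carrier; a prime ideal is proper, so nothing is lost.\<close>

locale jacobson_ring = cring R for R (structure) +
  assumes prime_eq_Inter_maximal:
    "primeideal P R \<Longrightarrow> \<exists>S. S \<noteq> {} \<and> (\<forall>M \<in> S. maximalideal M R) \<and> P = \<Inter>S"

lemma Metric_space_norm_dist:
  assumes R: "cring R"
    and nonneg: "\<And>x. x \<in> carrier R \<Longrightarrow> 0 \<le> N x"
    and zero: "\<And>x. x \<in> carrier R \<Longrightarrow> N x = 0 \<longleftrightarrow> x = \<zero>\<^bsub>R\<^esub>"
    and minus: "\<And>x. x \<in> carrier R \<Longrightarrow> N (\<ominus>\<^bsub>R\<^esub> x) = N x"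
    and ultra: "\<And>x y. \<lbrakk>x \<in> carrier R; y \<in> carrier R\<rbrakk> \<Longrightarrow> N (x \<oplus>\<^bsub>R\<^esub> y) \<le> max (N x) (N y)"
  shows "Metric_space (carrier R) (norm_dist R N)"
proof -
  interpret R: cring R by (rule R)
  show ?thesis
  proof
    fix x y show "0 \<le> norm_dist R N x y"
      by (simp add: norm_dist_def nonneg)
  next
    fix x y
    have "N (x \<ominus>\<^bsub>R\<^esub> y) = N (y \<ominus>\<^bsub>R\<^esub> x)" if "x \<in> carrier R" "y \<in> carrier R"
    proof -
      have "x \<ominus>\<^bsub>R\<^esub> y = \<ominus>\<^bsub>R\<^esub> (y \<ominus>\<^bsub>R\<^esub> x)"
        using that by (simp add: R.minus_eq R.minus_add R.a_comm)
      then show ?thesis using that by (simp add: minus)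
    qed
    then show "norm_dist R N x y = norm_dist R N y x"
      by (simp add: norm_dist_def)
  next
    fix x y assume "x \<in> carrier R" "y \<in> carrier R"
    then show "norm_dist R N x y = 0 \<longleftrightarrow> x = y"
      by (simp add: norm_dist_def zero)
  next
    fix x y z assume xyz: "x \<in> carrier R" "y \<in> carrier R" "z \<in> carrier R"
    have "x \<ominus>\<^bsub>R\<^esub> z = (x \<ominus>\<^bsub>R\<^esub> y) \<oplus>\<^bsub>R\<^esub> (y \<ominus>\<^bsub>R\<^esub> z)"
      using xyz by (simp add: R.minus_eq R.a_assoc R.r_neg1)
    then have "N (x \<ominus>\<^bsub>R\<^esub> z) \<le> max (N (x \<ominus>\<^bsub>R\<^esub> y)) (N (y \<ominus>\<^bsub>R\<^esub> z))"
      using xyz ultra by simp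
    also have "\<dots> \<le> N (x \<ominus>\<^bsub>R\<^esub> y) + N (y \<ominus>\<^bsub>R\<^esub> z)"
      using xyz nonneg by simp
    finally show "norm_dist R N x z \<le> norm_dist R N x y + norm_dist R N y z"
      using xyz by (simp add: norm_dist_def)
  qed
qed


lemma (in nonarchimedean_field) abs_minus:
  assumes "x \<in> carrier K"
  shows "v (\<ominus> x) = v x"
proof -
  have "v (\<ominus> x) * v (\<ominus> x) = v x * v x"
    using assms abs_mult[of x x] abs_mult[of "\<ominus> x" "\<ominus> x"] by (simp add: l_minus r_minus)
  then have "v (\<ominus> x) ^ 2 = v x ^ 2"
    by (simp add: power2_eq_square)
  then show ?thesis
    using assms abs_nonneg by (simp add: power2_eq_iff_nonneg)
qed

lemma (in nonarchimedean_field) Metric_space_abs: "Metric_space (carrier K) (norm_dist K v)"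
  by (rule Metric_space_norm_dist)
    (use abs_nonneg abs_eq_0_iff abs_minus abs_ultrametric is_cring in auto)

lemma (in nonarchimedean_field) abs_one: "v \<one> = 1"
  using abs_mult[of \<one> \<one>] abs_eq_0_iff[of \<one>] by simp

lemma (in nonarchimedean_banach_algebra) norm_minus:
  assumes "f \<in> carrier A"
  shows "N (\<ominus>\<^bsub>A\<^esub> f) = N f"
proof -
  have "\<ominus>\<^bsub>A\<^esub> f = (\<ominus>\<^bsub>K\<^esub> \<one>\<^bsub>K\<^esub>) \<odot>\<^bsub>A\<^esub> f"
    using assms by (simp add: smult_l_minus)
  then show ?thesis
    using assms norm_smult[of "\<ominus>\<^bsub>K\<^esub> \<one>\<^bsub>K\<^esub>" f] by (simp add: K.abs_minus K.abs_one)
qed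

lemma (in nonarchimedean_banach_algebra) Metric_space_norm:
  "Metric_space (carrier A) (norm_dist A N)"
  by (rule Metric_space_norm_dist)
    (use norm_nonneg norm_eq_0_iff norm_minus norm_ultrametric M_cring in auto)

end

theory Submission
  imports Defs "HOL-Analysis.Urysohn"
begin

text \<open>
  Let \<open>P\<close> be a prime of the Noetherian Banach algebra \<open>A\<close> and \<open>f \<notin> P\<close>. A maximal ideal containing
  \<open>P\<close> but not \<open>f\<close> has to be found. Suppose there is none, so that \<open>f\<close> lies in the Jacobson radical
  of the domain \<open>A / P\<close>. Then \<open>f - \<lambda>\<close> is invertible in \<open>A / P\<close> for every nonzero scalar \<open>\<lambda>\<close>. On the
  other hand, multiplication by \<open>f\<close> on \<open>A / P\<close> is injective with closed image, because every ideal
  of \<open>A\<close> is closed, so by the open mapping theorem it is bounded below, say by \<open>1 / C\<close>. If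
  \<open>|\<lambda>| < 1 / C\<close>, the ultrametric inequality transfers this bound to \<open>f - \<lambda>\<close>; hence the inverse \<open>u\<close> of
  \<open>f - \<lambda>\<close> has norm at most \<open>C\<close>, and \<open>f u = 1 + \<lambda> u\<close> with \<open>|\<lambda> u| < 1\<close> is invertible by a geometric
  series. So \<open>f\<close> is invertible in \<open>A / P\<close>, which contradicts that it lies in a maximal ideal.

  The quotient \<open>A / P\<close> and its norm are not constructed. An element of \<open>A / P\<close> is handled through
  representatives in \<open>A\<close>, and bounds on the quotient norm become the existence of a representative
  of bounded norm (\<open>mult_bounded_below_mod_prime\<close> and \<open>small_perturbation_unit_mod_prime\<close>).

  The functional analysis has one engine, \<open>lincomb_successive_approximation\<close>: if every element \<open>x\<close>
  of a set can be approximated within \<open>\<theta> |x|\<close>, \<open>\<theta> < 1\<close>, by a linear combination whose coefficients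
  have norm at most \<open>C |x|\<close>, and the error stays in the set, then \<open>x\<close> is exactly such a combination,
  with the same bound on the coefficients. It gives the geometric series, it upgrades the approximate
  solutions supplied by the Baire category theorem to the open mapping theorem
  (\<open>open_mapping_genideal\<close>), and it shows that an ideal with finitely generated closure is closed
  (\<open>noetherian_ideal_closed\<close>).

  The base field enters only through a nonzero scalar of absolute value less than \<open>1\<close>. Its image in
  \<open>A\<close> is a unit that multiplies all norms by a fixed factor, and the argument is carried out for
  complete ultrametric rings with such an element.
\<close>

section \<open>Maximal ideals and linear combinations\<close>

text \<open>The union of a nonempty chain of ideals of a Noetherian ring belongs to the chain, so Zorn's
  lemma applies to the ideals that contain \<open>Q\<close> and avoid \<open>\<one>\<close>.\<close>

lemma (in noetherian_ring) proper_ideal_le_maximalideal: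
  assumes Q: "ideal Q R" and proper: "\<one> \<notin> Q"
  obtains M where "maximalideal M R" "Q \<subseteq> M"
proof -
  let ?\<A> = "{I. ideal I R \<and> Q \<subseteq> I \<and> \<one> \<notin> I}"
  have "\<exists>M\<in>?\<A>. \<forall>X\<in>?\<A>. M \<subseteq> X \<longrightarrow> X = M"
  proof (rule subset_Zorn_nonempty)
    show "?\<A> \<noteq> {}" using assms by blast
    fix \<C> assume "\<C> \<noteq> {}" and ch: "subset.chain ?\<A> \<C>"
    moreover have "subset.chain {I. ideal I R} \<C>"
      using ch unfolding pred_on.chain_def by blast
    ultimately have "\<Union>\<C> \<in> \<C>" using ideal_chain_is_trivial by blast
    then show "\<Union>\<C> \<in> ?\<A>" using ch unfolding pred_on.chain_def by blast
  qed
  then obtain M where M\<A>: "M \<in> ?\<A>" and max: "\<forall>X\<in>?\<A>. M \<subseteq> X \<longrightarrow> X = M"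
    by (rule bexE)
  then have M: "ideal M R" "Q \<subseteq> M" "\<one> \<notin> M" by auto
  have "maximalideal M R"
  proof (rule maximalidealI[OF M(1)])
    show "carrier R \<noteq> M" using M(3) by auto
    fix J assume J: "ideal J R" "M \<subseteq> J" "J \<subseteq> carrier R"
    show "J = M \<or> J = carrier R"
    proof (cases "\<one> \<in> J")
      case True
      then show ?thesis using ideal.one_imp_carrier[OF J(1) True] by simp
    next
      case False
      then show ?thesis using max M(2) J by auto
    qed
  qed
  then show thesis using M(2) by (rule that)
qed

context cring
begin

text \<open>The vectors \<open>e\<close> form an indexed family rather than a set: in the proof that ideals are closed,
  distinct generators may be approximated by the same element.\<close>

definition lincomb :: "'i set \<Rightarrow> ('i \<Rightarrow> 'a) \<Rightarrow> ('i \<Rightarrow> 'a) \<Rightarrow> 'a" where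
  "lincomb I a e = (\<Oplus>i\<in>I. a i \<otimes> e i)"

lemma lincomb_closed [simp]:
  "a \<in> I \<rightarrow> carrier R \<Longrightarrow> e \<in> I \<rightarrow> carrier R \<Longrightarrow> lincomb I a e \<in> carrier R"
  unfolding lincomb_def by (rule finsum_closed) auto

lemma lincomb_add:
  assumes "a \<in> I \<rightarrow> carrier R" "b \<in> I \<rightarrow> carrier R" "e \<in> I \<rightarrow> carrier R"
  shows "lincomb I (\<lambda>i. a i \<oplus> b i) e = lincomb I a e \<oplus> lincomb I b e"
proof -
  have "lincomb I (\<lambda>i. a i \<oplus> b i) e = (\<Oplus>i\<in>I. a i \<otimes> e i \<oplus> b i \<otimes> e i)"
    unfolding lincomb_def by (rule finsum_cong') (use assms l_distr in \<open>auto simp: Pi_def\<close>)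
  then show ?thesis
    unfolding lincomb_def by (subst (asm) finsum_addf) (use assms in \<open>auto simp: Pi_def\<close>)
qed

lemma lincomb_smult:
  assumes "finite I" "c \<in> carrier R" "a \<in> I \<rightarrow> carrier R" "e \<in> I \<rightarrow> carrier R"
  shows "lincomb I (\<lambda>i. c \<otimes> a i) e = c \<otimes> lincomb I a e"
proof -
  have "c \<otimes> lincomb I a e = (\<Oplus>i\<in>I. c \<otimes> (a i \<otimes> e i))"
    unfolding lincomb_def by (rule finsum_rdistr) (use assms in \<open>auto simp: Pi_def\<close>)
  also have "\<dots> = lincomb I (\<lambda>i. c \<otimes> a i) e"
    unfolding lincomb_def by (rule finsum_cong') (use assms m_assoc in \<open>auto simp: Pi_def\<close>)
  finally show ?thesis by simp
qed

lemma lincomb_commute: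
  assumes "a \<in> I \<rightarrow> carrier R" "e \<in> I \<rightarrow> carrier R"
  shows "lincomb I a e = lincomb I e a"
  unfolding lincomb_def by (rule finsum_cong') (use assms m_comm in \<open>auto simp: Pi_def\<close>)

lemma lincomb_diff:
  assumes "a \<in> I \<rightarrow> carrier R" "b \<in> I \<rightarrow> carrier R" "e \<in> I \<rightarrow> carrier R"
  shows "lincomb I (\<lambda>i. a i \<ominus> b i) e = lincomb I a e \<ominus> lincomb I b e"
proof -
  \<comment> \<open>Additivity applied to \<open>a = (a - b) + b\<close>.\<close>
  have "lincomb I (\<lambda>i. (a i \<ominus> b i) \<oplus> b i) e = lincomb I a e"
    unfolding lincomb_def
    by (rule finsum_cong') (use assms in \<open>auto simp: Pi_def minus_eq a_assoc l_neg\<close>)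
  moreover have "lincomb I (\<lambda>i. (a i \<ominus> b i) \<oplus> b i) e
      = lincomb I (\<lambda>i. a i \<ominus> b i) e \<oplus> lincomb I b e"
    by (rule lincomb_add) (use assms in \<open>auto simp: Pi_def\<close>)
  moreover have "lincomb I (\<lambda>i. a i \<ominus> b i) e \<in> carrier R" "lincomb I b e \<in> carrier R"
    by (rule lincomb_closed; use assms in \<open>auto simp: Pi_def\<close>)+
  ultimately show ?thesis
    by (simp add: minus_eq a_assoc r_neg)
qed

lemma lincomb_mem_ideal:
  assumes "ideal J R" "finite I" "a \<in> I \<rightarrow> carrier R" "e \<in> I \<rightarrow> J"
  shows "lincomb I a e \<in> J"
  using assms(2,3,4) unfolding lincomb_def
proof (induction I rule: finite_induct)
  case empty
  then show ?case using assms(1) by (simp add: additive_subgroup.zero_closed ideal.axioms(1))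
next
  case (insert i I)
  have "e j \<in> carrier R" if "j \<in> insert i I" for j
    using that insert.prems ideal.Icarr[OF assms(1)] by blast
  then have "(\<Oplus>j\<in>insert i I. a j \<otimes> e j) = a i \<otimes> e i \<oplus> (\<Oplus>j\<in>I. a j \<otimes> e j)"
    using insert by (subst finsum_insert) (auto simp: Pi_def)
  moreover have "a i \<otimes> e i \<in> J"
    using insert.prems ideal.I_l_closed[OF assms(1)] by blast
  moreover have "(\<Oplus>j\<in>I. a j \<otimes> e j) \<in> J" using insert by simp
  ultimately show ?case
    using additive_subgroup.a_closed[OF ideal.axioms(1)[OF assms(1)]] by simp
qed

lemma genideal_eq_lincombs:
  assumes G: "finite G" "G \<subseteq> carrier R"
  shows "Idl G = {lincomb G a id |a. a \<in> G \<rightarrow> carrier R}" (is "_ = ?L")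
proof
  have id: "id \<in> G \<rightarrow> carrier R" using G by auto
  have "ideal ?L R"
  proof (rule idealI)
    show "ring R" by (rule ring_axioms)
    show "subgroup ?L (add_monoid R)"
    proof (rule add.subgroupI)
      show "?L \<subseteq> carrier R" using id by auto
      show "?L \<noteq> {}" by auto
    next
      fix x assume "x \<in> ?L"
      then obtain a where a: "a \<in> G \<rightarrow> carrier R" "x = lincomb G a id" by blast
      have "lincomb G (\<lambda>g. \<ominus> \<one> \<otimes> a g) id = \<ominus> \<one> \<otimes> x"
        unfolding a(2) by (rule lincomb_smult) (use G a id in auto)
      moreover have "x \<in> carrier R" using a id by simp
      moreover have "(\<lambda>g. \<ominus> \<one> \<otimes> a g) \<in> G \<rightarrow> carrier R" using a by auto
      ultimately show "\<ominus> x \<in> ?L"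
        by (intro CollectI exI[of _ "\<lambda>g. \<ominus> \<one> \<otimes> a g"]) (simp add: l_minus)
    next
      fix x y assume "x \<in> ?L" "y \<in> ?L"
      then obtain a b where ab: "a \<in> G \<rightarrow> carrier R" "x = lincomb G a id"
        "b \<in> G \<rightarrow> carrier R" "y = lincomb G b id" by blast
      then have "(\<lambda>g. a g \<oplus> b g) \<in> G \<rightarrow> carrier R" by (auto simp: Pi_def)
      then show "x \<oplus> y \<in> ?L"
        using lincomb_add[OF ab(1,3) id] ab(2,4)
        by (intro CollectI exI[of _ "\<lambda>g. a g \<oplus> b g"]) simp
    qed
    have "c \<otimes> x \<in> ?L" if "x \<in> ?L" "c \<in> carrier R" for x c
    proof -
      obtain a where a: "a \<in> G \<rightarrow> carrier R" "x = lincomb G a id" using \<open>x \<in> ?L\<close> by blast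
      moreover have "(\<lambda>g. c \<otimes> a g) \<in> G \<rightarrow> carrier R" using a that by (auto simp: Pi_def)
      ultimately show ?thesis
        using lincomb_smult[OF G(1) that(2) a(1) id]
        by (intro CollectI exI[of _ "\<lambda>g. c \<otimes> a g"]) simp
    qed
    moreover have "?L \<subseteq> carrier R" using id by auto
    ultimately show "c \<otimes> x \<in> ?L" "x \<otimes> c \<in> ?L" if "x \<in> ?L" "c \<in> carrier R" for x c
      using that m_comm[of x c] by (blast, metis (no_types, lifting) subsetD)
  qed
  moreover have "G \<subseteq> ?L"
  proof
    fix g assume g: "g \<in> G"
    have "lincomb G (\<lambda>h. if g = h then \<one> else \<zero>) id = (\<Oplus>h\<in>G. if g = h then h else \<zero>)"
      unfolding lincomb_def by (rule finsum_cong') (use G in auto)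
    also have "\<dots> = g" using add.finprod_singleton[OF g G(1), of "\<lambda>h. h"] G by (auto simp: Pi_def)
    finally have "g = lincomb G (\<lambda>h. if g = h then \<one> else \<zero>) id" by simp
    moreover have "(\<lambda>h. if g = h then \<one> else \<zero>) \<in> G \<rightarrow> carrier R" by auto
    ultimately show "g \<in> ?L" by blast
  qed
  ultimately show "Idl G \<subseteq> ?L" by (rule genideal_minimal)
  show "?L \<subseteq> Idl G"
  proof -
    have "id \<in> G \<rightarrow> Idl G" using genideal_self[OF G(2)] by auto
    then show ?thesis using lincomb_mem_ideal[OF genideal_ideal[OF G(2)] G(1)] by blast
  qed
qed

end

section \<open>Complete rings with a pseudo-uniformiser\<close>

text \<open>The element \<open>\<pi>\<close> is a topologically nilpotent unit whose multiplication scales norms exactly;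
  rings with such an element are known as Tate rings. Powers of \<open>\<pi>\<close> take over the role of
  the scalars of a base field.\<close>

locale tate_ring = cring R for R (structure) +
  fixes N :: "'a \<Rightarrow> real" and \<pi> :: 'a
  assumes norm_nonneg: "x \<in> carrier R \<Longrightarrow> 0 \<le> N x"
    and norm_eq_0_iff: "x \<in> carrier R \<Longrightarrow> N x = 0 \<longleftrightarrow> x = \<zero>"
    and norm_minus: "x \<in> carrier R \<Longrightarrow> N (\<ominus> x) = N x"
    and norm_ultrametric: "\<lbrakk>x \<in> carrier R; y \<in> carrier R\<rbrakk> \<Longrightarrow> N (x \<oplus> y) \<le> max (N x) (N y)"
    and norm_mult_le: "\<lbrakk>x \<in> carrier R; y \<in> carrier R\<rbrakk> \<Longrightarrow> N (x \<otimes> y) \<le> N x * N y"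
    and complete: "norm_complete R N"
    and unif_Unit: "\<pi> \<in> Units R"
    and norm_unif_pos: "0 < N \<pi>"
    and norm_unif_less_1: "N \<pi> < 1"
    and norm_unif_mult: "x \<in> carrier R \<Longrightarrow> N (\<pi> \<otimes> x) = N \<pi> * N x"
begin

lemma unif_closed [simp]: "\<pi> \<in> carrier R"
  using unif_Unit by (rule Units_closed)

lemma metric: "Metric_space (carrier R) (norm_dist R N)"
  by (rule Metric_space_norm_dist)
    (use norm_nonneg norm_eq_0_iff norm_minus norm_ultrametric is_cring in auto)

lemma norm_zero [simp]: "N \<zero> = 0"
  by (simp add: norm_eq_0_iff)

lemma norm_diff_le:
  "\<lbrakk>x \<in> carrier R; y \<in> carrier R\<rbrakk> \<Longrightarrow> N (x \<ominus> y) \<le> max (N x) (N y)"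
  using norm_ultrametric[of x "\<ominus> y"] by (simp add: minus_eq norm_minus)

lemma norm_diff_commute:
  assumes "x \<in> carrier R" "y \<in> carrier R"
  shows "N (x \<ominus> y) = N (y \<ominus> x)"
proof -
  have "x \<ominus> y = \<ominus> (y \<ominus> x)"
    using assms by (simp add: minus_eq minus_add a_comm)
  then show ?thesis using assms by (simp add: norm_minus)
qed

lemma norm_diff_trans:
  assumes "x \<in> carrier R" "y \<in> carrier R" "z \<in> carrier R"
  shows "N (x \<ominus> z) \<le> max (N (x \<ominus> y)) (N (y \<ominus> z))"
proof -
  have "x \<ominus> z = (x \<ominus> y) \<oplus> (y \<ominus> z)"
    using assms by (simp add: minus_eq a_assoc r_neg1)
  then show ?thesis using assms norm_ultrametric by simp
qed

lemma norm_finsum_le: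
  assumes "finite I" "x \<in> I \<rightarrow> carrier R" "0 \<le> B" "\<And>i. i \<in> I \<Longrightarrow> N (x i) \<le> B"
  shows "N (\<Oplus>i\<in>I. x i) \<le> B"
  using assms
proof (induction I rule: finite_induct)
  case empty
  then show ?case by simp
next
  case (insert i I)
  have "N (\<Oplus>j\<in>insert i I. x j) = N (x i \<oplus> (\<Oplus>j\<in>I. x j))"
    using insert by (subst finsum_insert) (auto simp: Pi_def)
  also have "\<dots> \<le> max (N (x i)) (N (\<Oplus>j\<in>I. x j))"
    by (rule norm_ultrametric) (use insert in \<open>auto intro!: finsum_closed\<close>)
  also have "\<dots> \<le> B" using insert by simp
  finally show ?case .
qed

lemma norm_lincomb_le:
  assumes I: "finite I" "a \<in> I \<rightarrow> carrier R" "e \<in> I \<rightarrow> carrier R"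
    and B: "0 \<le> B" "\<And>i. i \<in> I \<Longrightarrow> N (a i) \<le> B"
    and D: "0 \<le> D" "\<And>i. i \<in> I \<Longrightarrow> N (e i) \<le> D"
  shows "N (lincomb I a e) \<le> B * D"
  unfolding lincomb_def
proof (rule norm_finsum_le)
  fix i assume i: "i \<in> I"
  have "N (a i \<otimes> e i) \<le> N (a i) * N (e i)" using i I by (intro norm_mult_le) auto
  also have "\<dots> \<le> B * D" using i I B D by (intro mult_mono norm_nonneg) auto
  finally show "N (a i \<otimes> e i) \<le> B * D" .
qed (use I B D in \<open>auto simp: Pi_def\<close>)

lemma norm_family_bounded:
  assumes "finite I" "e \<in> I \<rightarrow> carrier R"
  obtains D where "0 \<le> D" "\<And>i. i \<in> I \<Longrightarrow> N (e i) \<le> D"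
proof
  show "0 \<le> (\<Sum>i\<in>I. N (e i))" using assms norm_nonneg by (intro sum_nonneg) auto
  show "N (e i) \<le> (\<Sum>i\<in>I. N (e i))" if "i \<in> I" for i
    using member_le_sum[OF that, of "\<lambda>i. N (e i)"] assms norm_nonneg by auto
qed

text \<open>Limits are taken in this quantitative form: the bound on the tails of a Cauchy sequence passes
  to the limit, since an ultrametric ball is closed.\<close>

lemma complete_with_rate:
  fixes s :: "nat \<Rightarrow> 'a"
  assumes s: "\<And>k. s k \<in> carrier R"
    and cau: "\<And>k m. k \<le> m \<Longrightarrow> N (s m \<ominus> s k) \<le> E k"
    and E: "E \<longlonglongrightarrow> 0"
  obtains b where "b \<in> carrier R" "\<And>k. N (b \<ominus> s k) \<le> E k"
proof -
  interpret M: Metric_space "carrier R" "norm_dist R N" by (rule metric)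
  have "M.MCauchy s"
    unfolding M.MCauchy_def
  proof (intro conjI allI impI)
    show "range s \<subseteq> carrier R" using s by auto
    fix e :: real assume "0 < e"
    then obtain n0 where n0: "\<And>n. n \<ge> n0 \<Longrightarrow> \<bar>E n\<bar> < e"
      using LIMSEQ_D[OF E] by fastforce
    have "norm_dist R N (s n) (s n') < e" if n: "n0 \<le> n" "n0 \<le> n'" for n n'
    proof -
      have "N (s n \<ominus> s n') \<le> max (N (s n \<ominus> s n0)) (N (s n0 \<ominus> s n'))"
        using s norm_diff_trans by blast
      also have "\<dots> \<le> E n0"
        using cau[OF n(1)] cau[OF n(2)] norm_diff_commute[OF s s] by simp
      finally show ?thesis using n0[of n0] s by (simp add: norm_dist_def)
    qed
    then show "\<exists>n0. \<forall>n n'. n0 \<le> n \<longrightarrow> n0 \<le> n' \<longrightarrow> norm_dist R N (s n) (s n') < e" by blast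
  qed
  then obtain b where b: "limitin M.mtopology s b sequentially"
    using complete unfolding norm_complete_def M.mcomplete_def by blast
  then have bc: "b \<in> carrier R" by (simp add: M.limit_metric_sequentially)
  have "N (b \<ominus> s k) \<le> E k" for k
  proof (rule field_le_epsilon)
    fix e :: real assume "0 < e"
    then obtain n0 where n0: "\<And>n. n \<ge> n0 \<Longrightarrow> norm_dist R N (s n) b < e"
      using b unfolding M.limit_metric_sequentially by blast
    let ?m = "max n0 k"
    have "N (b \<ominus> s k) \<le> max (N (b \<ominus> s ?m)) (N (s ?m \<ominus> s k))"
      using bc s norm_diff_trans by blast
    moreover have "N (b \<ominus> s ?m) < e"
      using n0[of ?m] bc s norm_diff_commute[OF bc s] by (simp add: norm_dist_def)
    moreover have "N (s ?m \<ominus> s k) \<le> E k" using cau by simp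
    moreover have "0 \<le> E k" using cau[of k k] norm_nonneg[of "s k \<ominus> s k"] s
      by (metis le_refl minus_closed order_trans)
    ultimately show "N (b \<ominus> s k) \<le> E k + e" using \<open>0 < e\<close> by linarith
  qed
  with bc show thesis by (rule that)
qed

text \<open>Iterating the hypothesis on the successive errors \<open>x = z 0, z 1, \<dots>\<close> gives errors of norm at most
  \<open>\<theta> ^ k * N x\<close>, so the corrections to the coefficients tend to \<open>0\<close> geometrically and their partial
  sums \<open>s k\<close> converge. By the ultrametric inequality a sum is bounded by its largest term, here the
  first one, so the limit coefficients obey the same bound \<open>C * N x\<close>.\<close>

lemma lincomb_successive_approximation:
  assumes I: "finite I" "e \<in> I \<rightarrow> carrier R"
    and J: "J \<subseteq> carrier R"
    and C: "0 \<le> C" and \<theta>: "0 \<le> \<theta>" "\<theta> < 1"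
    and step: "\<And>x. x \<in> J \<Longrightarrow> \<exists>a \<in> I \<rightarrow> carrier R. (\<forall>i\<in>I. N (a i) \<le> C * N x)
        \<and> x \<ominus> lincomb I a e \<in> J \<and> N (x \<ominus> lincomb I a e) \<le> \<theta> * N x"
    and x: "x \<in> J"
  obtains b where "b \<in> I \<rightarrow> carrier R" "\<And>i. i \<in> I \<Longrightarrow> N (b i) \<le> C * N x" "x = lincomb I b e"
proof -
  obtain \<alpha> where \<alpha>: "\<And>y. y \<in> J \<Longrightarrow> \<alpha> y \<in> I \<rightarrow> carrier R"
      "\<And>y i. y \<in> J \<Longrightarrow> i \<in> I \<Longrightarrow> N (\<alpha> y i) \<le> C * N y"
      "\<And>y. y \<in> J \<Longrightarrow> y \<ominus> lincomb I (\<alpha> y) e \<in> J"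
      "\<And>y. y \<in> J \<Longrightarrow> N (y \<ominus> lincomb I (\<alpha> y) e) \<le> \<theta> * N y"
    using step by metis
  define z where "z = rec_nat x (\<lambda>_ y. y \<ominus> lincomb I (\<alpha> y) e)"
  define s where "s = rec_nat (\<lambda>_. \<zero>) (\<lambda>k t i. t i \<oplus> \<alpha> (z k) i)"
  have z_simps: "z 0 = x" "\<And>k. z (Suc k) = z k \<ominus> lincomb I (\<alpha> (z k)) e"
    by (simp_all add: z_def)
  have s_simps: "\<And>i. s 0 i = \<zero>" "\<And>k i. s (Suc k) i = s k i \<oplus> \<alpha> (z k) i"
    by (simp_all add: s_def)
  have zJ: "z k \<in> J" for k by (induction k) (use x \<alpha> z_simps in auto)
  then have zc: "z k \<in> carrier R" for k using J by auto
  have sc: "s k \<in> I \<rightarrow> carrier R" for k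
  proof (induction k)
    case (Suc k)
    then show ?case using \<alpha>(1)[OF zJ[of k]] by (auto simp: s_simps Pi_def)
  qed (auto simp: s_simps)
  have xc: "x \<in> carrier R" using x J by auto
  have zN: "N (z k) \<le> \<theta> ^ k * N x" for k
  proof (induction k)
    case (Suc k)
    have "N (z (Suc k)) \<le> \<theta> * N (z k)" using \<alpha>(4)[OF zJ] by (simp add: z_simps)
    also have "\<dots> \<le> \<theta> * (\<theta> ^ k * N x)" using Suc \<theta> by (intro mult_left_mono) auto
    finally show ?case by simp
  qed (simp add: z_simps)
  have x_eq: "x \<ominus> lincomb I (s k) e = z k" for k
  proof (induction k)
    case 0
    have "lincomb I (s 0) e = (\<Oplus>i\<in>I. \<zero>)"
      unfolding lincomb_def by (rule finsum_cong') (use I in \<open>auto simp: s_simps Pi_iff\<close>)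
    then show ?case using xc by (simp add: z_simps minus_eq)
  next
    case (Suc k)
    have l: "lincomb I (s k) e \<in> carrier R" "lincomb I (\<alpha> (z k)) e \<in> carrier R"
      using sc \<alpha>(1)[OF zJ] I by auto
    have "lincomb I (s (Suc k)) e = lincomb I (s k) e \<oplus> lincomb I (\<alpha> (z k)) e"
      using lincomb_add[OF sc[of k] \<alpha>(1)[OF zJ[of k]] I(2)] by (simp add: s_def)
    then have "x \<ominus> lincomb I (s (Suc k)) e = x \<ominus> lincomb I (s k) e \<ominus> lincomb I (\<alpha> (z k)) e"
      using l xc by (simp add: minus_eq minus_add a_assoc)
    then show ?case using Suc by (simp add: z_simps)
  qed
  define E where "E k = C * (\<theta> ^ k * N x)" for k
  have E0: "0 \<le> E k" for k using C \<theta> norm_nonneg[OF xc] by (simp add: E_def)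
  have "(\<lambda>k. C * (\<theta> ^ k * N x)) \<longlonglongrightarrow> C * (0 * N x)"
    by (intro tendsto_intros LIMSEQ_realpow_zero \<theta>)
  then have E: "E \<longlonglongrightarrow> 0" unfolding E_def by simp
  have Emono: "E m \<le> E k" if "k \<le> m" for k m
    unfolding E_def using C \<theta> norm_nonneg[OF xc] that
    by (intro mult_left_mono mult_right_mono power_decreasing) auto
  have cau: "N (s m i \<ominus> s k i) \<le> E k" if "k \<le> m" "i \<in> I" for k m i
    using that(1)
  proof (induction m rule: dec_induct)
    case base
    have "s k i \<ominus> s k i = \<zero>" using funcset_mem[OF sc[of k] that(2)] by (simp add: minus_eq r_neg)
    then show ?case using E0 by (simp add: norm_eq_0_iff)
  next
    case (step m)
    have c: "s m i \<in> carrier R" "s k i \<in> carrier R" "\<alpha> (z m) i \<in> carrier R"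
      using sc \<alpha>(1)[OF zJ[of m]] that(2) by auto
    have "s (Suc m) i \<ominus> s k i = (s m i \<ominus> s k i) \<oplus> \<alpha> (z m) i"
      using c by (simp add: s_simps minus_eq a_ac)
    then have "N (s (Suc m) i \<ominus> s k i) \<le> max (N (s m i \<ominus> s k i)) (N (\<alpha> (z m) i))"
      using norm_ultrametric c by simp
    moreover have "N (\<alpha> (z m) i) \<le> E m"
    proof -
      have "N (\<alpha> (z m) i) \<le> C * N (z m)" using \<alpha>(2)[OF zJ that(2)] .
      also have "\<dots> \<le> E m" unfolding E_def using zN C by (intro mult_left_mono)
      finally show ?thesis .
    qed
    moreover have "E m \<le> E k" using Emono step by simp
    ultimately show ?case using step by linarith
  qed
  have "\<exists>b. b \<in> carrier R \<and> (\<forall>k. N (b \<ominus> s k i) \<le> E k)" if "i \<in> I" for i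
  proof (rule complete_with_rate[of "\<lambda>k. s k i" E])
    show "s k i \<in> carrier R" for k using funcset_mem[OF sc that] .
    show "N (s m i \<ominus> s k i) \<le> E k" if "k \<le> m" for k m using cau[OF that \<open>i \<in> I\<close>] .
    show "E \<longlonglongrightarrow> 0" by (rule E)
  qed blast
  then obtain b where b: "\<And>i. i \<in> I \<Longrightarrow> b i \<in> carrier R"
    "\<And>i k. i \<in> I \<Longrightarrow> N (b i \<ominus> s k i) \<le> E k" by metis
  have bI: "b \<in> I \<rightarrow> carrier R" using b by auto
  \<comment> \<open>Since \<open>s 0 = 0\<close>, the rate of convergence at \<open>k = 0\<close> bounds the limit itself.\<close>
  have bN: "N (b i) \<le> C * N x" if "i \<in> I" for i
    using b[OF that] b(2)[OF that, of 0] by (simp add: s_simps E_def minus_eq)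
  obtain D where D: "0 \<le> D" "\<And>i. i \<in> I \<Longrightarrow> N (e i) \<le> D"
    using norm_family_bounded[OF I] by blast
  let ?d = "x \<ominus> lincomb I b e"
  have dc: "?d \<in> carrier R" using xc bI I by simp
  have d: "N ?d \<le> \<theta> ^ k * N x + E k * D" for k
  proof -
    have l: "lincomb I b e \<in> carrier R" "lincomb I (s k) e \<in> carrier R" using bI sc I by auto
    have "N ?d \<le> max (N (x \<ominus> lincomb I (s k) e)) (N (lincomb I (s k) e \<ominus> lincomb I b e))"
      using norm_diff_trans xc l by blast
    moreover have "N (x \<ominus> lincomb I (s k) e) \<le> \<theta> ^ k * N x" by (simp add: x_eq zN)
    moreover have "N (lincomb I (s k) e \<ominus> lincomb I b e) \<le> E k * D"
    proof -
      have "N (lincomb I (s k) e \<ominus> lincomb I b e) = N (lincomb I (\<lambda>i. b i \<ominus> s k i) e)"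
        using lincomb_diff[OF bI sc I(2)] norm_diff_commute[OF l] by simp
      also have "\<dots> \<le> E k * D"
        by (rule norm_lincomb_le) (use I bI sc[of k] b E0 D in \<open>auto simp: Pi_def\<close>)
      finally show ?thesis .
    qed
    moreover have "0 \<le> \<theta> ^ k * N x" "0 \<le> E k * D" using E0 D \<theta> norm_nonneg[OF xc] by auto
    ultimately show ?thesis by linarith
  qed
  have "(\<lambda>k. \<theta> ^ k * N x + E k * D) \<longlonglongrightarrow> 0 * N x + 0 * D"
    by (intro tendsto_intros E LIMSEQ_realpow_zero \<theta>)
  then have "(\<lambda>k. \<theta> ^ k * N x + E k * D) \<longlonglongrightarrow> 0" by simp
  then have "N ?d \<le> 0" by (rule LIMSEQ_le_const) (use d in auto)
  then have "?d = \<zero>" using norm_eq_0_iff[OF dc] norm_nonneg[OF dc] by simp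
  then have "x = lincomb I b e" using xc bI I by (simp add: r_right_minus_eq)
  with bI bN show thesis by (rule that)
qed

text \<open>The geometric series, as an instance of successive approximation: \<open>x\<close> is approximated by the
  multiple \<open>x \<otimes> (\<one> \<ominus> z)\<close> of \<open>\<one> \<ominus> z\<close> up to the error \<open>z \<otimes> x\<close>, so every \<open>x\<close>, in particular \<open>\<one>\<close>, is a
  multiple of \<open>\<one> \<ominus> z\<close>.\<close>

lemma one_minus_small_invertible:
  assumes z: "z \<in> carrier R" "N z < 1"
  obtains w where "w \<in> carrier R" "w \<otimes> (\<one> \<ominus> z) = \<one>"
proof -
  let ?e = "\<lambda>_::unit. \<one> \<ominus> z"
  have lc: "lincomb {()} a ?e = a () \<otimes> (\<one> \<ominus> z)" if "a \<in> {()} \<rightarrow> carrier R" for a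
    using that z by (simp add: lincomb_def finsum_insert Pi_def)
  have st: "\<exists>a \<in> {()} \<rightarrow> carrier R. (\<forall>i\<in>{()}. N (a i) \<le> 1 * N x)
        \<and> x \<ominus> lincomb {()} a ?e \<in> carrier R \<and> N (x \<ominus> lincomb {()} a ?e) \<le> N z * N x"
    if x: "x \<in> carrier R" for x
  proof (rule bexI[where x = "\<lambda>_. x"])
    have "x \<ominus> x \<otimes> (\<one> \<ominus> z) = z \<otimes> x" using x z
      by (simp add: minus_eq r_distr minus_add r_minus a_assoc[symmetric] r_neg m_comm)
    then show "(\<forall>i\<in>{()}. N x \<le> 1 * N x) \<and> x \<ominus> lincomb {()} (\<lambda>_. x) ?e \<in> carrier R
        \<and> N (x \<ominus> lincomb {()} (\<lambda>_. x) ?e) \<le> N z * N x"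
      using x z norm_mult_le[OF z(1) x] by (simp add: lc)
  qed (use x in auto)
  obtain b where "b \<in> {()} \<rightarrow> carrier R" "\<one> = lincomb {()} b ?e"
    by (rule lincomb_successive_approximation[of "{()}" ?e "carrier R" 1 "N z" \<one>])
      (use st z norm_nonneg in auto)
  then show thesis using that[of "b ()"] lc[of b] by auto
qed

section \<open>Closed ideals and the open mapping theorem\<close>

definition norm_closure :: "'a set \<Rightarrow> 'a set" where
  "norm_closure J = {x \<in> carrier R. \<forall>\<epsilon>>0. \<exists>y\<in>J. N (x \<ominus> y) < \<epsilon>}"

lemma subset_norm_closure: "J \<subseteq> carrier R \<Longrightarrow> J \<subseteq> norm_closure J"
  unfolding norm_closure_def
  by (auto intro!: exI bexI simp: minus_eq r_neg norm_eq_0_iff subsetD)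

lemma norm_closure_idem:
  assumes J: "J \<subseteq> carrier R"
  shows "norm_closure (norm_closure J) = norm_closure J"
proof
  show "norm_closure J \<subseteq> norm_closure (norm_closure J)"
    by (rule subset_norm_closure) (auto simp: norm_closure_def)
  show "norm_closure (norm_closure J) \<subseteq> norm_closure J"
  proof
    fix x assume x: "x \<in> norm_closure (norm_closure J)"
    then have xc: "x \<in> carrier R" by (simp add: norm_closure_def)
    have "\<exists>y\<in>J. N (x \<ominus> y) < \<epsilon>" if "0 < \<epsilon>" for \<epsilon>
    proof -
      obtain z where z: "z \<in> norm_closure J" "N (x \<ominus> z) < \<epsilon>"
        using x \<open>0 < \<epsilon>\<close> unfolding norm_closure_def[of "norm_closure J"] by blast
      then obtain y where y: "y \<in> J" "N (z \<ominus> y) < \<epsilon>" "z \<in> carrier R"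
        using \<open>0 < \<epsilon>\<close> unfolding norm_closure_def by blast
      then have "N (x \<ominus> y) < \<epsilon>" using norm_diff_trans[OF xc y(3), of y] z J by auto
      then show ?thesis using y by blast
    qed
    then show "x \<in> norm_closure J" using xc by (simp add: norm_closure_def)
  qed
qed

lemma ideal_norm_closure:
  assumes J: "ideal J R"
  shows "ideal (norm_closure J) R"
proof (rule idealI)
  interpret J: ideal J R by (rule J)
  have Jc: "J \<subseteq> carrier R" using J.a_subset .
  have smult: "c \<otimes> x \<in> norm_closure J" if x: "x \<in> norm_closure J" and c: "c \<in> carrier R" for x c
  proof -
    have xc: "x \<in> carrier R" using x by (simp add: norm_closure_def)
    have "\<exists>y\<in>J. N (c \<otimes> x \<ominus> y) < \<epsilon>" if e: "0 < \<epsilon>" for \<epsilon>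
    proof -
      have Nc: "0 \<le> N c" using norm_nonneg c by simp
      then have "0 < \<epsilon> / (N c + 1)" using e by simp
      then obtain y where y: "y \<in> J" "N (x \<ominus> y) < \<epsilon> / (N c + 1)"
        using x by (auto simp: norm_closure_def)
      have yc: "y \<in> carrier R" using y Jc by auto
      have "c \<otimes> x \<ominus> c \<otimes> y = c \<otimes> (x \<ominus> y)" using c xc yc by (simp add: minus_eq r_distr r_minus)
      then have "N (c \<otimes> x \<ominus> c \<otimes> y) \<le> N c * N (x \<ominus> y)" using norm_mult_le c xc yc by simp
      also have "\<dots> \<le> (N c + 1) * N (x \<ominus> y)"
        using norm_nonneg xc yc by (intro mult_right_mono) auto
      also have "\<dots> < \<epsilon>" using y(2) Nc by (simp add: field_simps)
      finally show ?thesis using J.I_l_closed[OF y(1) c] by blast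
    qed
    then show ?thesis using c xc by (simp add: norm_closure_def)
  qed
  show "subgroup (norm_closure J) (add_monoid R)"
  proof (rule add.subgroupI)
    show "norm_closure J \<subseteq> carrier R" by (auto simp: norm_closure_def)
    show "norm_closure J \<noteq> {}" using subset_norm_closure[OF Jc] J.zero_closed by blast
  next
    fix x assume x: "x \<in> norm_closure J"
    then have "x \<in> carrier R" by (simp add: norm_closure_def)
    then show "\<ominus> x \<in> norm_closure J" using smult[OF x, of "\<ominus> \<one>"] by (simp add: l_minus)
  next
    fix x y assume xy: "x \<in> norm_closure J" "y \<in> norm_closure J"
    then have c: "x \<in> carrier R" "y \<in> carrier R" by (auto simp: norm_closure_def)
    have "\<exists>w\<in>J. N (x \<oplus> y \<ominus> w) < \<epsilon>" if "0 < \<epsilon>" for \<epsilon>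
    proof -
      obtain x' y' where w: "x' \<in> J" "N (x \<ominus> x') < \<epsilon>" "y' \<in> J" "N (y \<ominus> y') < \<epsilon>"
        using xy \<open>0 < \<epsilon>\<close> unfolding norm_closure_def by blast
      then have c': "x' \<in> carrier R" "y' \<in> carrier R" using Jc by auto
      have "x \<oplus> y \<ominus> (x' \<oplus> y') = (x \<ominus> x') \<oplus> (y \<ominus> y')"
        using c c' by (simp add: minus_eq minus_add a_ac)
      then have "N (x \<oplus> y \<ominus> (x' \<oplus> y')) < \<epsilon>"
        using norm_ultrametric[of "x \<ominus> x'" "y \<ominus> y'"] c c' w by simp
      then show ?thesis using w J.a_closed by blast
    qed
    then show "x \<oplus> y \<in> norm_closure J" using c by (simp add: norm_closure_def)
  qed
  show "c \<otimes> x \<in> norm_closure J" "x \<otimes> c \<in> norm_closure J"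
    if "x \<in> norm_closure J" "c \<in> carrier R" for x c
    using smult[OF that] m_comm[of c x] that by (auto simp: norm_closure_def)
qed (rule ring_axioms)

text \<open>The Baire category theorem for a closed subset \<open>J\<close>, with the topology expressed by the norm: one
  of countably many sets covering \<open>J\<close> is dense in some ball of \<open>J\<close>.\<close>

lemma closed_countable_Union_somewhere_dense:
  fixes X :: "nat \<Rightarrow> 'a set"
  assumes J: "J \<subseteq> carrier R" "norm_closure J = J" "J \<noteq> {}"
    and X: "J = (\<Union>n. X n)"
  obtains n x r where "x \<in> J" "0 < r"
    "\<And>y \<epsilon>. \<lbrakk>y \<in> J; N (x \<ominus> y) < r; 0 < \<epsilon>\<rbrakk> \<Longrightarrow> \<exists>u\<in>X n. N (y \<ominus> u) < \<epsilon>"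
proof -
  interpret M: Metric_space "carrier R" "norm_dist R N" by (rule metric)
  interpret S: Submetric "carrier R" "norm_dist R N" J by unfold_locales (rule J)
  have dist: "norm_dist R N x y = N (x \<ominus> y)" if "x \<in> J" "y \<in> J" for x y
    using that J by (auto simp: norm_dist_def)
  have "closedin M.mtopology J"
    unfolding M.metric_closedin_iff_sequentially_closed
  proof (intro conjI allI impI J(1))
    fix \<sigma> l assume \<sigma>: "range \<sigma> \<subseteq> J \<and> limitin M.mtopology \<sigma> l sequentially"
    then have l: "l \<in> carrier R" using M.limitin_mspace by blast
    have "\<exists>y\<in>J. N (l \<ominus> y) < \<epsilon>" if "0 < \<epsilon>" for \<epsilon>
    proof -
      have "\<exists>n0. \<forall>n\<ge>n0. \<sigma> n \<in> carrier R \<and> norm_dist R N (\<sigma> n) l < \<epsilon>"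
        using \<sigma> \<open>0 < \<epsilon>\<close> by (simp add: M.limit_metric_sequentially)
      then obtain n where "norm_dist R N (\<sigma> n) l < \<epsilon>" by blast
      moreover have "\<sigma> n \<in> J" using \<sigma> by blast
      ultimately show ?thesis
        using l J(1) norm_diff_commute[of l "\<sigma> n"]
        by (intro bexI[of _ "\<sigma> n"]) (auto simp: norm_dist_def split: if_splits)
    qed
    then have "l \<in> norm_closure J" using l by (simp add: norm_closure_def)
    then show "l \<in> J" using J by simp
  qed
  then have comp: "S.sub.mcomplete"
    using complete S.closedin_mcomplete_imp_mcomplete unfolding norm_complete_def by blast
  define T where "T n = S.sub.mtopology closure_of X n" for n
  have "X n \<subseteq> T n" for n
    unfolding T_def by (rule closure_of_subset) (use X S.sub.topspace_mtopology in blast)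
  moreover have "T n \<subseteq> J" for n
    unfolding T_def using closure_of_subset_topspace[of S.sub.mtopology] by simp
  ultimately have "\<Union>(range T) = J" using X by blast
  then have "S.sub.mtopology interior_of \<Union>(range T) \<noteq> {}"
    using J(3) interior_of_topspace[of S.sub.mtopology] by simp
  moreover have "closedin S.sub.mtopology (T n)" for n by (simp add: T_def)
  ultimately obtain n where "S.sub.mtopology interior_of T n \<noteq> {}"
    using S.sub.metric_Baire_category_alt[OF comp, of "range T"] by auto
  then obtain x where x: "x \<in> S.sub.mtopology interior_of T n" by blast
  then obtain r where r: "0 < r" "S.sub.mball x r \<subseteq> S.sub.mtopology interior_of T n"
    using openin_interior_of S.sub.openin_mtopology by metis
  have xJ: "x \<in> J" using x interior_of_subset_topspace[of S.sub.mtopology] by auto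
  show thesis
  proof (rule that[OF xJ r(1)])
    fix y \<epsilon> assume y: "y \<in> J" "N (x \<ominus> y) < r" and \<epsilon>: "0 < (\<epsilon>::real)"
    have "y \<in> S.sub.mball x r" using y xJ dist by simp
    then have "y \<in> T n" using r(2) interior_of_subset[of S.sub.mtopology "T n"] by (meson subsetD)
    then have "\<forall>r>0. \<exists>u\<in>X n. u \<in> S.sub.mball y r"
      unfolding T_def S.sub.metric_closure_of by simp
    then obtain u where "u \<in> X n" "u \<in> S.sub.mball y \<epsilon>" using \<epsilon> by blast
    then show "\<exists>u\<in>X n. N (y \<ominus> u) < \<epsilon>" using dist by auto
  qed
qed

lemma norm_unif_power_mult:
  "x \<in> carrier R \<Longrightarrow> N (\<pi> [^] (n::nat) \<otimes> x) = N \<pi> ^ n * N x"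
proof (induction n)
  case (Suc n)
  have "\<pi> [^] Suc n \<otimes> x = \<pi> \<otimes> (\<pi> [^] n \<otimes> x)"
    using Suc.prems by (simp add: m_ac)
  then show ?case using Suc norm_unif_mult by simp
qed simp

text \<open>Every positive number \<open>t\<close>, used below for the norm of an element, is moved into the interval
  from \<open>N \<pi> * r\<close> to \<open>r\<close> by some integral power \<open>c\<close> of \<open>\<pi>\<close>; \<open>c'\<close> is its inverse and \<open>\<rho>\<close> its norm factor.
  First \<open>t\<close> is enlarged to at least \<open>r\<close> by a power of \<open>inv \<pi>\<close>, then it is scaled down by \<open>\<pi>\<close> until it drops
  below \<open>r\<close> for the first time; the last step loses no more than a factor \<open>N \<pi>\<close>.\<close>

lemma scaling_into_annulus:
  assumes "0 < t" "0 < r"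
  obtains c c' \<rho> where "c \<in> carrier R" "c' \<in> carrier R" "c' \<otimes> c = \<one>"
    "0 < \<rho>" "\<And>x. x \<in> carrier R \<Longrightarrow> N (c \<otimes> x) = \<rho> * N x"
    "\<And>x. x \<in> carrier R \<Longrightarrow> N (c' \<otimes> x) = N x / \<rho>"
    "N \<pi> * r \<le> \<rho> * t" "\<rho> * t < r"
proof -
  let ?p = "N \<pi>" and ?q = "inv \<pi>"
  note p = norm_unif_pos norm_unif_less_1
  have inv: "?q \<in> carrier R" "?q \<otimes> \<pi> = \<one>" "\<pi> \<otimes> ?q = \<one>" using unif_Unit by auto
  have cancel: "?q [^] n \<otimes> \<pi> [^] n = \<one>" for n :: nat
    using pow_mult_distrib[of ?q \<pi> n] inv m_comm by (simp add: nat_pow_distrib[symmetric])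
  have invN: "N (?q [^] n \<otimes> x) = N x / ?p ^ n" if x: "x \<in> carrier R" for x and n :: nat
  proof -
    have "\<pi> [^] n \<otimes> (?q [^] n \<otimes> x) = x"
      using x inv cancel[of n] m_comm[of "\<pi> [^] n" "?q [^] n"] by (simp add: m_assoc[symmetric])
    then have "N x = ?p ^ n * N (?q [^] n \<otimes> x)"
      using norm_unif_power_mult[of "?q [^] n \<otimes> x" n] x inv by simp
    then show ?thesis using p by simp
  qed
  obtain m where "?p ^ m < t / r" using real_arch_pow_inv[of "t / r" ?p] p assms by auto
  then have m: "r \<le> t / ?p ^ m" using p assms by (simp add: field_simps)
  let ?s = "t / ?p ^ m"
  have s: "0 < ?s" using p assms by simp
  obtain n0 where n0: "?p ^ n0 < r / ?s" using real_arch_pow_inv[of "r / ?s" ?p] p assms s by auto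
  define n where "n = (LEAST n. ?p ^ n * ?s < r)"
  have "?p ^ n0 * ?s < r" using n0 s by (simp only: pos_less_divide_eq)
  then have n: "?p ^ n * ?s < r" unfolding n_def by (rule LeastI)
  then have "n \<noteq> 0" using m by (metis mult_1 not_le power_0)
  then obtain k where k: "n = Suc k" by (cases n) auto
  then have "r \<le> ?p ^ k * ?s"
    using not_less_Least[of k "\<lambda>n. ?p ^ n * ?s < r"] unfolding n_def[symmetric] by simp
  then have "?p * r \<le> ?p * (?p ^ k * ?s)" using p by (intro mult_left_mono) auto
  then have lower: "?p * r \<le> ?p ^ n * ?s" by (simp add: k mult.assoc)
  let ?\<rho> = "?p ^ n / ?p ^ m"
  show thesis
  proof (rule that[of "\<pi> [^] n \<otimes> ?q [^] m" "?q [^] n \<otimes> \<pi> [^] m" ?\<rho>])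
    have "(?q [^] n \<otimes> \<pi> [^] m) \<otimes> (\<pi> [^] n \<otimes> ?q [^] m)
        = (?q [^] n \<otimes> \<pi> [^] n) \<otimes> (?q [^] m \<otimes> \<pi> [^] m)"
      using inv by (simp add: m_ac)
    then show "(?q [^] n \<otimes> \<pi> [^] m) \<otimes> (\<pi> [^] n \<otimes> ?q [^] m) = \<one>" by (simp add: cancel)
    show "N ((\<pi> [^] n \<otimes> ?q [^] m) \<otimes> x) = ?\<rho> * N x" if "x \<in> carrier R" for x
      using that inv invN by (simp add: m_assoc norm_unif_power_mult)
    show "N ((?q [^] n \<otimes> \<pi> [^] m) \<otimes> x) = N x / ?\<rho>" if "x \<in> carrier R" for x
      using that inv invN by (simp add: m_assoc norm_unif_power_mult)
  qed (use inv p lower n in auto)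
qed

text \<open>The open mapping theorem for the surjection from the free module on \<open>G\<close> to the closed ideal
  generated by \<open>G\<close>. The combinations \<open>X n\<close> with coefficients of norm at most \<open>n\<close> cover the ideal, so by
  Baire some \<open>X n\<close> is dense in a ball. As \<open>X n\<close> is an additive group by the ultrametric inequality, the
  ball can be moved to the origin. Scaling into that ball turns density into an approximation of any
  \<open>x\<close> up to an error \<open>N \<pi> * N x\<close>, and successive approximation removes the error.\<close>

theorem open_mapping_genideal:
  assumes G: "finite G" "G \<subseteq> carrier R" and closed: "norm_closure (Idl G) = Idl G"
  obtains C where "0 \<le> C"
    "\<And>x. x \<in> Idl G \<Longrightarrow>
      \<exists>a \<in> G \<rightarrow> carrier R. (\<forall>g\<in>G. N (a g) \<le> C * N x) \<and> x = lincomb G a id"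
proof -
  let ?p = "N \<pi>"
  note p = norm_unif_pos norm_unif_less_1
  interpret J: ideal "Idl G" R by (rule genideal_ideal[OF G(2)])
  have Jc: "Idl G \<subseteq> carrier R" by (rule J.a_subset)
  have id: "id \<in> G \<rightarrow> carrier R" using G by auto
  define X where "X n = {lincomb G a id |a. a \<in> G \<rightarrow> carrier R \<and> (\<forall>g\<in>G. N (a g) \<le> real n)}" for n
  have lcJ: "lincomb G a id \<in> Idl G" if "a \<in> G \<rightarrow> carrier R" for a
    using that genideal_eq_lincombs[OF G] by blast
  have XJ: "X n \<subseteq> Idl G" for n unfolding X_def using lcJ by blast
  have "Idl G = (\<Union>n. X n)"
  proof
    show "Idl G \<subseteq> (\<Union>n. X n)"
    proof
      fix x assume "x \<in> Idl G"
      then obtain a where a: "a \<in> G \<rightarrow> carrier R" "x = lincomb G a id"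
        using genideal_eq_lincombs[OF G] by blast
      obtain D where "\<And>g. g \<in> G \<Longrightarrow> N (a g) \<le> D"
        using norm_family_bounded[OF G(1) a(1)] by blast
      moreover obtain n where "D \<le> real n" using real_arch_simple by blast
      ultimately have "x \<in> X n" unfolding X_def using a by fastforce
      then show "x \<in> (\<Union>n. X n)" by blast
    qed
  qed (use XJ in blast)
  then obtain n x0 r where x0: "x0 \<in> Idl G" and r: "0 < r"
    and dense: "\<And>y \<epsilon>. \<lbrakk>y \<in> Idl G; N (x0 \<ominus> y) < r; 0 < \<epsilon>\<rbrakk> \<Longrightarrow> \<exists>u\<in>X n. N (y \<ominus> u) < \<epsilon>"
    using closed_countable_Union_somewhere_dense[OF Jc closed, of X] J.zero_closed
    by (metis empty_iff)
  have X_diff: "u \<ominus> w \<in> X n" if uw: "u \<in> X n" "w \<in> X n" for u w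
  proof -
    obtain a b where ab: "a \<in> G \<rightarrow> carrier R" "\<forall>g\<in>G. N (a g) \<le> real n" "u = lincomb G a id"
      "b \<in> G \<rightarrow> carrier R" "\<forall>g\<in>G. N (b g) \<le> real n" "w = lincomb G b id"
      using uw unfolding X_def by blast
    have "u \<ominus> w = lincomb G (\<lambda>g. a g \<ominus> b g) id" using lincomb_diff[OF _ _ id] ab by simp
    moreover have "(\<lambda>g. a g \<ominus> b g) \<in> G \<rightarrow> carrier R" using ab by (auto simp: Pi_def)
    moreover have "N (a g \<ominus> b g) \<le> real n" if "g \<in> G" for g
      using norm_diff_le[of "a g" "b g"] ab that by fastforce
    ultimately show ?thesis unfolding X_def by blast
  qed
  have dense0: "\<exists>u\<in>X n. N (y \<ominus> u) < \<epsilon>" if y: "y \<in> Idl G" "N y < r" and \<epsilon>: "0 < \<epsilon>" for y \<epsilon>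
  proof -
    have c: "y \<in> carrier R" "x0 \<in> carrier R" using y x0 Jc by auto
    \<comment> \<open>Both \<open>x0\<close> and \<open>y + x0\<close> lie in the ball around \<open>x0\<close>; approximate both and subtract.\<close>
    have "x0 \<ominus> x0 = \<zero>" "x0 \<ominus> (y \<oplus> x0) = \<ominus> y"
      using c by (auto simp: minus_eq r_neg minus_add a_ac r_neg2)
    then have "N (x0 \<ominus> x0) < r" "N (x0 \<ominus> (y \<oplus> x0)) < r"
      using y r c by (simp_all only: norm_minus norm_zero)
    then obtain u w where u: "u \<in> X n" "N (x0 \<ominus> u) < \<epsilon>" and w: "w \<in> X n" "N (y \<oplus> x0 \<ominus> w) < \<epsilon>"
      using dense[OF x0 _ \<epsilon>] dense[OF J.a_closed[OF y(1) x0] _ \<epsilon>] by blast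
    have c': "u \<in> carrier R" "w \<in> carrier R" using u w XJ Jc by blast+
    have "y \<ominus> (w \<ominus> u) = (y \<oplus> x0 \<ominus> w) \<ominus> (x0 \<ominus> u)"
      using c c' by algebra
    then have "N (y \<ominus> (w \<ominus> u)) < \<epsilon>"
      using norm_diff_le[of "y \<oplus> x0 \<ominus> w" "x0 \<ominus> u"] u w c c' by simp
    then show ?thesis using X_diff u w by blast
  qed
  define C where "C = real n / (?p * r)"
  have C: "0 \<le> C" unfolding C_def using p r by simp
  have step: "\<exists>a \<in> G \<rightarrow> carrier R. (\<forall>g\<in>G. N (a g) \<le> C * N x)
        \<and> x \<ominus> lincomb G a id \<in> Idl G \<and> N (x \<ominus> lincomb G a id) \<le> ?p * N x"
    if x: "x \<in> Idl G" for x
  proof (cases "x = \<zero>")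
    case True
    have "lincomb G (\<lambda>_. \<zero>) id = (\<Oplus>i\<in>G. \<zero>)"
      unfolding lincomb_def by (rule finsum_cong') (use G in auto)
    then show ?thesis using True J.zero_closed
      by (intro bexI[where x = "\<lambda>_. \<zero>"]) (auto simp: norm_eq_0_iff minus_eq)
  next
    case False
    have xc: "x \<in> carrier R" using x Jc by auto
    have "0 < N x" using False norm_nonneg[OF xc] norm_eq_0_iff[OF xc] by simp
    then obtain c c' \<rho> where c: "c \<in> carrier R" "c' \<in> carrier R" "c' \<otimes> c = \<one>"
      and \<rho>: "0 < \<rho>" "\<And>x. x \<in> carrier R \<Longrightarrow> N (c \<otimes> x) = \<rho> * N x"
        "\<And>x. x \<in> carrier R \<Longrightarrow> N (c' \<otimes> x) = N x / \<rho>"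
      and ann: "?p * r \<le> \<rho> * N x" "\<rho> * N x < r"
      using scaling_into_annulus[OF _ r] by metis
    have "c \<otimes> x \<in> Idl G" using J.I_l_closed x c by simp
    moreover have "N (c \<otimes> x) < r" using \<rho>(2)[OF xc] ann by simp
    \<comment> \<open>The tolerance is \<open>N \<pi>\<close> times the lower bound \<open>N \<pi> * r\<close> for the norm of \<open>c \<otimes> x\<close>, so that after
      scaling back the error is at most \<open>N \<pi> * N x\<close>.\<close>
    moreover have "0 < ?p * (?p * r)" using p r by simp
    ultimately obtain u where u: "u \<in> X n" "N (c \<otimes> x \<ominus> u) < ?p * (?p * r)"
      using dense0 by blast
    then obtain a where a: "a \<in> G \<rightarrow> carrier R" "\<forall>g\<in>G. N (a g) \<le> real n" "u = lincomb G a id"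
      unfolding X_def by blast
    have uc: "u \<in> carrier R" using a id by simp
    have ac: "(\<lambda>g. c' \<otimes> a g) \<in> G \<rightarrow> carrier R" using a c by (auto simp: Pi_def)
    have l: "lincomb G (\<lambda>g. c' \<otimes> a g) id = c' \<otimes> u"
      using lincomb_smult[OF G(1) c(2) a(1) id] a(3) by simp
    have "c' \<otimes> (c \<otimes> x) = x" using c xc by (simp add: m_assoc[symmetric])
    then have eq: "x \<ominus> c' \<otimes> u = c' \<otimes> (c \<otimes> x \<ominus> u)"
      using c xc uc by (simp add: minus_eq r_distr r_minus)
    have "N (x \<ominus> c' \<otimes> u) \<le> ?p * N x"
    proof -
      have "N (x \<ominus> c' \<otimes> u) = N (c \<otimes> x \<ominus> u) / \<rho>" using eq \<rho>(3) c xc uc by simp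
      also have "\<dots> \<le> ?p * (?p * r) / \<rho>" using u \<rho> by (intro divide_right_mono) auto
      also have "\<dots> \<le> ?p * (\<rho> * N x) / \<rho>"
        using ann p \<rho> by (intro divide_right_mono mult_left_mono) auto
      finally show ?thesis using \<rho> by simp
    qed
    moreover have "N (c' \<otimes> a g) \<le> C * N x" if "g \<in> G" for g
    proof -
      have "N (c' \<otimes> a g) = N (a g) / \<rho>" using \<rho>(3) a that by auto
      also have "\<dots> \<le> real n / \<rho>" using a that \<rho> by (intro divide_right_mono) auto
      also have "\<dots> \<le> C * N x"
      proof -
        have "real n * (?p * r) \<le> real n * (\<rho> * N x)" using ann by (intro mult_left_mono) auto
        then show ?thesis unfolding C_def using \<rho> p r by (simp add: field_simps)
      qed
      finally show ?thesis .
    qed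
    moreover have "x \<ominus> c' \<otimes> u \<in> Idl G"
      using x lcJ[OF ac] l J.a_closed J.a_inv_closed by (simp add: minus_eq)
    ultimately show ?thesis using ac l by (intro bexI[OF _ ac]) simp
  qed
  show thesis
  proof (rule that[OF C])
    fix x assume x: "x \<in> Idl G"
    show "\<exists>a \<in> G \<rightarrow> carrier R. (\<forall>g\<in>G. N (a g) \<le> C * N x) \<and> x = lincomb G a id"
      using lincomb_successive_approximation[OF G(1) id Jc C _ norm_unif_less_1 step x] p
      by (metis less_imp_le)
  qed
qed

text \<open>The closure of \<open>J\<close> is generated by a finite set \<open>G\<close>, with coefficients bounded by the open mapping
  theorem. Elements \<open>h g\<close> of \<open>J\<close> sufficiently close to the generators \<open>g\<close> generate the closure as well:
  replacing \<open>g\<close> by \<open>h g\<close> in a combination that represents \<open>x\<close> changes it by at most half the norm of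
  \<open>x\<close>, and successive approximation applies. Hence the closure is contained in \<open>J\<close>.\<close>

theorem noetherian_ideal_closed:
  assumes noeth: "noetherian_ring R" and J: "ideal J R"
  shows "norm_closure J = J"
proof
  interpret J: ideal J R by (rule J)
  have Jc: "J \<subseteq> carrier R" by (rule J.a_subset)
  let ?K = "norm_closure J"
  have K: "ideal ?K R" by (rule ideal_norm_closure[OF J])
  interpret K: ideal ?K R by (rule K)
  obtain G where G: "finite G" "G \<subseteq> carrier R" "?K = Idl G"
    using noetherian_ring.finetely_gen[OF noeth K] by blast
  have id: "id \<in> G \<rightarrow> carrier R" using G by auto
  obtain C where C: "0 \<le> C" "\<And>x. x \<in> Idl G \<Longrightarrow>
      \<exists>a \<in> G \<rightarrow> carrier R. (\<forall>g\<in>G. N (a g) \<le> C * N x) \<and> x = lincomb G a id"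
    using open_mapping_genideal[OF G(1,2)] norm_closure_idem[OF Jc] G(3) by metis
  define \<eta> where "\<eta> = 1 / (2 * (C + 1))"
  have \<eta>: "0 < \<eta>" "C * \<eta> \<le> 1 / 2" unfolding \<eta>_def using C by (auto simp: field_simps)
  have "\<exists>y\<in>J. N (g \<ominus> y) < \<eta>" if "g \<in> G" for g
    using that G genideal_self[OF G(2)] \<eta> unfolding norm_closure_def by blast
  then obtain h where h: "\<And>g. g \<in> G \<Longrightarrow> h g \<in> J" "\<And>g. g \<in> G \<Longrightarrow> N (g \<ominus> h g) < \<eta>" by metis
  have hJ: "h \<in> G \<rightarrow> J" and hc: "h \<in> G \<rightarrow> carrier R" using h Jc by auto
  have dc: "(\<lambda>g. id g \<ominus> h g) \<in> G \<rightarrow> carrier R" using hc G by (auto simp: Pi_def)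
  have step: "\<exists>a \<in> G \<rightarrow> carrier R. (\<forall>g\<in>G. N (a g) \<le> C * N x)
        \<and> x \<ominus> lincomb G a h \<in> ?K \<and> N (x \<ominus> lincomb G a h) \<le> 1 / 2 * N x"
    if x: "x \<in> ?K" for x
  proof -
    obtain a where a: "a \<in> G \<rightarrow> carrier R" "\<forall>g\<in>G. N (a g) \<le> C * N x" "x = lincomb G a id"
      using C(2) x G(3) by blast
    have xc: "x \<in> carrier R" using a id by simp
    have "x \<ominus> lincomb G a h = lincomb G a (\<lambda>g. id g \<ominus> h g)"
      using lincomb_diff[OF id hc a(1)] lincomb_commute[OF a(1)] id hc dc a(3) by simp
    also have "N \<dots> \<le> (C * N x) * \<eta>"
      by (rule norm_lincomb_le)
        (use G a dc C h \<eta> norm_nonneg[OF xc] in \<open>auto intro: less_imp_le\<close>)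
    also have "\<dots> \<le> 1 / 2 * N x"
      using mult_right_mono[OF \<eta>(2) norm_nonneg[OF xc]] by (simp add: mult_ac)
    finally have "N (x \<ominus> lincomb G a h) \<le> 1 / 2 * N x" .
    moreover have "lincomb G a h \<in> ?K"
      using lincomb_mem_ideal[OF J G(1) a(1) hJ] subset_norm_closure[OF Jc] by blast
    then have "x \<ominus> lincomb G a h \<in> ?K"
      using x K.a_closed K.a_inv_closed by (simp add: minus_eq)
    ultimately show ?thesis using a by blast
  qed
  show "?K \<subseteq> J"
  proof
    fix x assume x: "x \<in> ?K"
    obtain b where "b \<in> G \<rightarrow> carrier R" "x = lincomb G b h"
      by (rule lincomb_successive_approximation[OF G(1) hc K.a_subset C(1) _ _ step x]) auto
    then show "x \<in> J" using lincomb_mem_ideal[OF J G(1) _ hJ] by blast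
  qed
  show "J \<subseteq> ?K" by (rule subset_norm_closure[OF Jc])
qed

section \<open>Inverting elements modulo a prime\<close>

text \<open>Multiplication by \<open>f\<close> on \<open>R / P\<close> is bounded below: for each representative \<open>x\<close> of the class of
  \<open>f \<otimes> y\<close> the class of \<open>y\<close> has a representative \<open>a\<close> of norm at most \<open>C * N x\<close>. To find \<open>a\<close>, write
  \<open>x\<close> with bounded coefficients in terms of \<open>f\<close> and generators of \<open>P\<close>. The coefficient of \<open>f\<close> is
  congruent to \<open>y\<close>, because \<open>f\<close> can be cancelled modulo the prime \<open>P\<close>.\<close>

lemma mult_bounded_below_mod_prime:
  assumes noeth: "noetherian_ring R" and P: "primeideal P R"
    and f: "f \<in> carrier R" "f \<notin> P"
  obtains C where "0 \<le> C"
    "\<And>x y. \<lbrakk>x \<in> carrier R; y \<in> carrier R; x \<ominus> f \<otimes> y \<in> P\<rbrakk>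
      \<Longrightarrow> \<exists>a \<in> carrier R. a \<ominus> y \<in> P \<and> N a \<le> C * N x"
proof -
  interpret P: primeideal P R by (rule P)
  obtain G where G: "finite G" "G \<subseteq> carrier R" "P = Idl G"
    using noetherian_ring.finetely_gen[OF noeth P.is_ideal] by blast
  have GP: "G \<subseteq> P" using G genideal_self by simp
  then have fG: "f \<notin> G" using f by blast
  let ?F = "insert f G"
  have F: "finite ?F" "?F \<subseteq> carrier R" using G f by auto
  interpret J: ideal "Idl ?F" R by (rule genideal_ideal[OF F(2)])
  have FJ: "?F \<subseteq> Idl ?F" by (rule genideal_self[OF F(2)])
  then have PJ: "P \<subseteq> Idl ?F" using genideal_minimal[OF J.is_ideal, of G] G(3) by blast
  obtain C where C: "0 \<le> C" "\<And>x. x \<in> Idl ?F \<Longrightarrow>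
      \<exists>a \<in> ?F \<rightarrow> carrier R. (\<forall>g\<in>?F. N (a g) \<le> C * N x) \<and> x = lincomb ?F a id"
    using open_mapping_genideal[OF F noetherian_ideal_closed[OF noeth J.is_ideal]] by metis
  show thesis
  proof (rule that[OF C(1)])
    fix x y assume xy: "x \<in> carrier R" "y \<in> carrier R" "x \<ominus> f \<otimes> y \<in> P"
    have "f \<otimes> y \<in> Idl ?F" using J.I_r_closed FJ xy by blast
    then have "(x \<ominus> f \<otimes> y) \<oplus> f \<otimes> y \<in> Idl ?F" using xy PJ J.a_closed by blast
    moreover have "(x \<ominus> f \<otimes> y) \<oplus> f \<otimes> y = x" using xy f by (simp add: minus_eq a_assoc l_neg)
    ultimately have "x \<in> Idl ?F" by simp
    then obtain a where a: "a \<in> ?F \<rightarrow> carrier R" "\<forall>g\<in>?F. N (a g) \<le> C * N x" "x = lincomb ?F a id"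
      using C(2) by blast
    let ?q = "lincomb G a id"
    have afc: "a f \<in> carrier R" using a by auto
    have qP: "?q \<in> P"
      by (rule lincomb_mem_ideal) (use P.is_ideal G(1) a GP in auto)
    then have qc: "?q \<in> carrier R" using P.Icarr by blast
    have x_eq: "x = a f \<otimes> f \<oplus> ?q"
      unfolding a(3) lincomb_def by (subst finsum_insert) (use G f fG a in \<open>auto simp: Pi_def\<close>)
    have "(a f \<ominus> y) \<otimes> f = (x \<ominus> f \<otimes> y) \<ominus> ?q"
      unfolding x_eq using afc f xy qc by algebra
    then have "(a f \<ominus> y) \<otimes> f \<in> P"
      using xy qP P.a_closed P.a_inv_closed by (simp add: minus_eq)
    then have "a f \<ominus> y \<in> P" using P.I_prime[of "a f \<ominus> y" f] afc xy f by auto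
    then show "\<exists>a \<in> carrier R. a \<ominus> y \<in> P \<and> N a \<le> C * N x" using afc a by auto
  qed
qed

text \<open>If \<open>f \<ominus> l\<close> is invertible modulo \<open>P\<close> for a sufficiently small \<open>l\<close>, then so is \<open>f\<close>. Let \<open>u\<close> be an
  inverse of \<open>f \<ominus> l\<close>; then \<open>f \<otimes> u\<close> is congruent to \<open>\<one> \<oplus> l \<otimes> u\<close>, which is a unit of \<open>R\<close> once \<open>u\<close> has
  been replaced by a congruent element of norm at most \<open>D + 1\<close> with \<open>D = C * N \<one>\<close>. The lower bound for
  multiplication by \<open>f\<close> replaces \<open>u\<close> by a congruent element of norm at most
  \<open>C * max (N \<one>) (N l * N u)\<close>, that is, at most \<open>D\<close> or half of \<open>N u\<close>; repeating this brings the norm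
  down to at most \<open>D + 1\<close>.\<close>

lemma small_perturbation_unit_mod_prime:
  assumes noeth: "noetherian_ring R" and P: "primeideal P R"
    and f: "f \<in> carrier R" "f \<notin> P"
  obtains \<delta> where "0 < \<delta>"
    "\<And>l u. \<lbrakk>l \<in> carrier R; N l < \<delta>; u \<in> carrier R; \<one> \<ominus> (f \<ominus> l) \<otimes> u \<in> P\<rbrakk>
      \<Longrightarrow> \<exists>w \<in> carrier R. \<one> \<ominus> f \<otimes> w \<in> P"
proof -
  interpret P: primeideal P R by (rule P)
  obtain C where C: "0 \<le> C" "\<And>x y. \<lbrakk>x \<in> carrier R; y \<in> carrier R; x \<ominus> f \<otimes> y \<in> P\<rbrakk>
      \<Longrightarrow> \<exists>a \<in> carrier R. a \<ominus> y \<in> P \<and> N a \<le> C * N x"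
    using mult_bounded_below_mod_prime[OF assms] by metis
  define D where "D = C * N \<one>"
  have D: "0 \<le> D" unfolding D_def using C norm_nonneg by simp
  \<comment> \<open>The first bound gives the factor one half at each replacement of \<open>u\<close>, the second makes the norm of \<open>l \<otimes> u\<close> less than
    \<open>1\<close> at the end.\<close>
  define \<delta> where "\<delta> = min (1 / (2 * (C + 1))) (1 / (D + 1))"
  have \<delta>: "0 < \<delta>" unfolding \<delta>_def using C D by simp
  show thesis
  proof (rule that[OF \<delta>])
    fix l u assume l: "l \<in> carrier R" "N l < \<delta>" and u: "u \<in> carrier R" "\<one> \<ominus> (f \<ominus> l) \<otimes> u \<in> P"
    have Nl: "0 \<le> N l" using l norm_nonneg by simp
    have "C * N l \<le> C * (1 / (2 * (C + 1)))" using l C unfolding \<delta>_def by (intro mult_left_mono) auto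
    also have "\<dots> \<le> 1 / 2" using C by (simp add: field_simps)
    finally have Cl: "C * N l \<le> 1 / 2" .
    have lD: "N l * (D + 1) < 1" using l D unfolding \<delta>_def by (simp add: field_simps)
    have "\<exists>u \<in> carrier R. \<one> \<ominus> (f \<ominus> l) \<otimes> u \<in> P \<and> N u \<le> max D (N u0 / 2 ^ k)"
      if u0: "u0 = u" for u0 k
    proof (induction k)
      case 0
      then show ?case using u u0 by auto
    next
      case (Suc k)
      then obtain y where y: "y \<in> carrier R" "\<one> \<ominus> (f \<ominus> l) \<otimes> y \<in> P" "N y \<le> max D (N u0 / 2 ^ k)"
        by blast
      let ?x = "\<one> \<oplus> l \<otimes> y"
      have "?x \<ominus> f \<otimes> y = \<one> \<ominus> (f \<ominus> l) \<otimes> y" using l f y by algebra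
      then obtain a where a: "a \<in> carrier R" "a \<ominus> y \<in> P" "N a \<le> C * N ?x"
        using C(2)[of ?x y] y l by auto
      have "\<one> \<ominus> (f \<ominus> l) \<otimes> a = (\<one> \<ominus> (f \<ominus> l) \<otimes> y) \<ominus> (f \<ominus> l) \<otimes> (a \<ominus> y)"
        using l f y a by algebra
      then have "\<one> \<ominus> (f \<ominus> l) \<otimes> a \<in> P"
        using y a l f P.I_l_closed[OF a(2), of "f \<ominus> l"] P.a_closed P.a_inv_closed
        by (simp add: minus_eq)
      moreover have "N a \<le> max D (N u0 / 2 ^ Suc k)"
      proof -
        have "N ?x \<le> max (N \<one>) (N l * N y)"
          using norm_ultrametric[of \<one> "l \<otimes> y"] norm_mult_le[of l y] l y by fastforce
        then have "C * N ?x \<le> C * max (N \<one>) (N l * N y)" using C by (intro mult_left_mono)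
        also have "\<dots> = max D (C * N l * N y)" using C by (simp add: D_def max_mult_distrib_left)
        also have "\<dots> \<le> max D (1 / 2 * N y)"
          using mult_right_mono[OF Cl norm_nonneg[OF y(1)]] by auto
        also have "\<dots> \<le> max D (N u0 / 2 ^ Suc k)" using y(3) D by (auto simp: max_def split: if_splits)
        finally show ?thesis using a by simp
      qed
      ultimately show ?case using a by blast
    qed
    moreover obtain k where k: "N u / 2 ^ k \<le> D + 1"
    proof -
      have "0 < (D + 1) / (N u + 1)" using D norm_nonneg[OF u(1)] by simp
      then obtain k where "(1 / 2) ^ k < (D + 1) / (N u + 1)"
        using real_arch_pow_inv[of _ "1 / 2"] by auto
      then have "(N u + 1) * (1 / 2) ^ k < D + 1"
        using norm_nonneg[OF u(1)] by (simp add: field_simps)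
      moreover have "N u * (1 / 2) ^ k \<le> (N u + 1) * (1 / 2) ^ k" by (intro mult_right_mono) auto
      ultimately show ?thesis using that[of k] by (simp add: power_one_over)
    qed
    ultimately obtain y where y: "y \<in> carrier R" "\<one> \<ominus> (f \<ominus> l) \<otimes> y \<in> P" "N y \<le> max D (N u / 2 ^ k)"
      by blast
    have "N (\<ominus> (l \<otimes> y)) \<le> N l * N y" using norm_mult_le l y by (simp add: norm_minus)
    also have "\<dots> \<le> N l * (D + 1)" using y(3) k Nl by (intro mult_left_mono) auto
    also note lD
    finally obtain v where v: "v \<in> carrier R" "v \<otimes> (\<one> \<ominus> \<ominus> (l \<otimes> y)) = \<one>"
      using one_minus_small_invertible[of "\<ominus> (l \<otimes> y)"] l y by auto
    have v': "v \<otimes> (\<one> \<oplus> l \<otimes> y) = \<one>" using v l y by (simp add: minus_eq)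
    have "v \<otimes> (\<one> \<ominus> (f \<ominus> l) \<otimes> y) = v \<otimes> (\<one> \<oplus> l \<otimes> y) \<ominus> f \<otimes> (y \<otimes> v)"
      using v(1) l f y by algebra
    then have "\<one> \<ominus> f \<otimes> (y \<otimes> v) = v \<otimes> (\<one> \<ominus> (f \<ominus> l) \<otimes> y)" using v' by simp
    then have "\<one> \<ominus> f \<otimes> (y \<otimes> v) \<in> P" using P.I_l_closed[OF y(2) v(1)] by simp
    then show "\<exists>w \<in> carrier R. \<one> \<ominus> f \<otimes> w \<in> P" using y v by blast
  qed
qed

text \<open>Suppose that \<open>f\<close> lies in every maximal ideal above \<open>P\<close>. For a small power \<open>l\<close> of \<open>\<pi>\<close>, a maximal
  ideal containing \<open>P\<close> and \<open>f \<ominus> l\<close> would contain the unit \<open>l\<close>; so \<open>f \<ominus> l\<close> is invertible modulo \<open>P\<close>, hence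
  so is \<open>f\<close>, and \<open>f\<close> lies in no maximal ideal above \<open>P\<close>.\<close>

theorem prime_avoided_by_maximal:
  assumes noeth: "noetherian_ring R" and P: "primeideal P R"
    and f: "f \<in> carrier R" "f \<notin> P"
  obtains M where "maximalideal M R" "P \<subseteq> M" "f \<notin> M"
proof (rule ccontr)
  assume "\<not> thesis"
  with that have all: "\<And>M. maximalideal M R \<Longrightarrow> P \<subseteq> M \<Longrightarrow> f \<in> M" by blast
  interpret noetherian_ring R by (rule noeth)
  interpret P: primeideal P R by (rule P)
  obtain \<delta> where \<delta>: "0 < \<delta>"
    "\<And>l u. \<lbrakk>l \<in> carrier R; N l < \<delta>; u \<in> carrier R; \<one> \<ominus> (f \<ominus> l) \<otimes> u \<in> P\<rbrakk>
      \<Longrightarrow> \<exists>w \<in> carrier R. \<one> \<ominus> f \<otimes> w \<in> P"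
    using small_perturbation_unit_mod_prime[OF assms] by metis
  have N1: "0 < N \<one>"
    using P.I_notcarr P.one_imp_carrier P.zero_closed norm_nonneg[of \<one>] norm_eq_0_iff[of \<one>]
    by (metis less_eq_real_def one_closed)
  obtain n where "N \<pi> ^ n < \<delta> / N \<one>"
    using real_arch_pow_inv[of "\<delta> / N \<one>" "N \<pi>"] norm_unif_less_1 \<delta>(1) N1 by auto
  then have "N \<pi> ^ n * N \<one> < \<delta>" using N1 by (simp add: field_simps)
  moreover define l where "l = \<pi> [^] n"
  ultimately have l: "l \<in> carrier R" "N l < \<delta>" "l \<in> Units R"
    using norm_unif_power_mult[OF one_closed, of n] unif_Unit by (auto simp: Units_pow_closed)
  let ?Q = "PIdl (f \<ominus> l) <+>\<^bsub>R\<^esub> P"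
  have hc: "f \<ominus> l \<in> carrier R" using f l by simp
  have Q: "ideal ?Q R" by (rule add_ideals[OF cgenideal_ideal[OF hc] P.is_ideal])
  have "\<zero> \<in> PIdl (f \<ominus> l)"
    using cgenideal_ideal[OF hc] by (simp add: additive_subgroup.zero_closed ideal.axioms(1))
  then have "\<zero> \<oplus> x \<in> ?Q" if "x \<in> P" for x
    using that unfolding set_add_def' by blast
  then have PQ: "P \<subseteq> ?Q" using P.Icarr by auto
  have "(f \<ominus> l) \<oplus> \<zero> \<in> ?Q"
    using cgenideal_self[OF hc] P.zero_closed unfolding set_add_def' by blast
  then have hQ: "f \<ominus> l \<in> ?Q" using hc by simp
  have "\<one> \<in> ?Q"
  proof (rule ccontr)
    assume "\<one> \<notin> ?Q"
    then obtain M where M: "maximalideal M R" "?Q \<subseteq> M"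
      using proper_ideal_le_maximalideal[OF Q] by blast
    interpret M: maximalideal M R by (rule M)
    have "f \<in> M" "f \<ominus> l \<in> M" using all[OF M(1)] M(2) PQ hQ by auto
    then have "f \<oplus> \<ominus> (f \<ominus> l) \<in> M" using M.a_closed M.a_inv_closed by blast
    moreover have "f \<oplus> \<ominus> (f \<ominus> l) = l" using f l by algebra
    ultimately have "l \<in> M" by simp
    then have "inv l \<otimes> l \<in> M" by (rule M.I_l_closed[OF _ Units_inv_closed[OF l(3)]])
    then show False using l M.one_imp_carrier M.I_notcarr by auto
  qed
  then obtain u p where u: "u \<in> carrier R" "p \<in> P" "\<one> = u \<otimes> (f \<ominus> l) \<oplus> p"
    unfolding set_add_def' cgenideal_def by blast
  have "\<one> \<ominus> (f \<ominus> l) \<otimes> u = p"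
    unfolding u(3) using u(1) hc P.Icarr[OF u(2)] by algebra
  then obtain w where w: "w \<in> carrier R" "\<one> \<ominus> f \<otimes> w \<in> P"
    using \<delta>(2)[OF l(1,2) u(1)] u(2) by auto
  have "\<one> \<notin> P" using P.I_notcarr P.one_imp_carrier by blast
  then obtain M where M: "maximalideal M R" "P \<subseteq> M"
    using proper_ideal_le_maximalideal[OF P.is_ideal] by blast
  interpret M: maximalideal M R by (rule M)
  have "f \<otimes> w \<in> M" using all[OF M] M.I_r_closed w by blast
  then have "(\<one> \<ominus> f \<otimes> w) \<oplus> f \<otimes> w \<in> M" using w M(2) M.a_closed by blast
  moreover have "(\<one> \<ominus> f \<otimes> w) \<oplus> f \<otimes> w = \<one>" using w f by (simp add: minus_eq a_assoc l_neg)
  ultimately show False using M.one_imp_carrier M.I_notcarr by auto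
qed

theorem noetherian_imp_jacobson:
  assumes noeth: "noetherian_ring R"
  shows "jacobson_ring R"
proof (intro jacobson_ring.intro jacobson_ring_axioms.intro is_cring)
  fix P assume P: "primeideal P R"
  interpret P: primeideal P R by (rule P)
  let ?S = "{M. maximalideal M R \<and> P \<subseteq> M}"
  have "\<one> \<notin> P" using P.I_notcarr P.one_imp_carrier by blast
  then obtain M0 where M0: "maximalideal M0 R" "P \<subseteq> M0"
    by (rule noetherian_ring.proper_ideal_le_maximalideal[OF noeth P.is_ideal])
  have "\<Inter>?S \<subseteq> P"
  proof
    fix f assume f: "f \<in> \<Inter>?S"
    then have "f \<in> M0" using M0 by blast
    then have fc: "f \<in> carrier R" by (rule ideal.Icarr[OF maximalideal.axioms(1)[OF M0(1)]])
    show "f \<in> P"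
    proof (rule ccontr)
      assume "f \<notin> P"
      then obtain M' where "maximalideal M' R" "P \<subseteq> M'" "f \<notin> M'"
        by (rule prime_avoided_by_maximal[OF noeth P fc])
      then show False using f by blast
    qed
  qed
  then have "P = \<Inter>?S" by blast
  moreover have "?S \<noteq> {}" using M0 by blast
  ultimately show "\<exists>S. S \<noteq> {} \<and> (\<forall>M\<in>S. maximalideal M R) \<and> P = \<Inter>S"
    by (intro exI[of _ ?S]) simp
qed

end

section \<open>Noetherian Banach algebras\<close>

lemma (in nonarchimedean_field) exists_small_unit:
  obtains c where "c \<in> carrier K" "c \<noteq> \<zero>" "0 < v c" "v c < 1"
proof -
  obtain x where x: "x \<in> carrier K" "x \<noteq> \<zero>" "v x \<noteq> 1" using abs_nontrivial by blast
  then have pos: "0 < v x" using abs_nonneg[OF x(1)] abs_eq_0_iff[OF x(1)] by simp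
  show thesis
  proof (cases "v x < 1")
    case True
    then show ?thesis using that x pos by blast
  next
    case False
    have u: "x \<in> Units K" using x field_Units by simp
    then have i: "inv x \<in> carrier K" "inv x \<otimes> x = \<one>" by auto
    then have "v (inv x) * v x = 1" using abs_mult[OF i(1) x(1)] abs_one by simp
    then have vi: "v (inv x) = 1 / v x" using pos by (simp add: field_simps)
    have "inv x \<noteq> \<zero>" using i(2) x(1) by (metis l_null zero_not_one)
    then show ?thesis using that[OF i(1)] vi pos False x(3) by simp
  qed
qed

text \<open>The pseudo-uniformiser is the image of a scalar; multiplication by it scales norms exactly
  because the norm of the algebra is homogeneous over \<open>K\<close>.\<close>

lemma (in nonarchimedean_banach_algebra) exists_tate_ring: "\<exists>\<pi>. tate_ring A N \<pi>"
proof -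
  obtain c where c: "c \<in> carrier K" "c \<noteq> \<zero>\<^bsub>K\<^esub>" "0 < v c" "v c < 1"
    using K.exists_small_unit by blast
  let ?\<pi> = "c \<odot>\<^bsub>A\<^esub> \<one>\<^bsub>A\<^esub>"
  have mult: "?\<pi> \<otimes>\<^bsub>A\<^esub> x = c \<odot>\<^bsub>A\<^esub> x" if "x \<in> carrier A" for x
    using that c smult_assoc2[of c "\<one>\<^bsub>A\<^esub>" x] by simp
  have Npi: "N ?\<pi> = v c" using norm_smult[OF c(1), of "\<one>\<^bsub>A\<^esub>"] norm_one by simp
  have "c \<in> Units K" using c K.field_Units by simp
  then have i: "inv\<^bsub>K\<^esub> c \<in> carrier K" "c \<otimes>\<^bsub>K\<^esub> inv\<^bsub>K\<^esub> c = \<one>\<^bsub>K\<^esub>" by auto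
  have "?\<pi> \<otimes>\<^bsub>A\<^esub> (inv\<^bsub>K\<^esub> c \<odot>\<^bsub>A\<^esub> \<one>\<^bsub>A\<^esub>) = \<one>\<^bsub>A\<^esub>"
    using mult[of "inv\<^bsub>K\<^esub> c \<odot>\<^bsub>A\<^esub> \<one>\<^bsub>A\<^esub>"] smult_assoc1[of c "inv\<^bsub>K\<^esub> c" "\<one>\<^bsub>A\<^esub>"] i c by simp
  then have "?\<pi> \<in> Units A"
    using i(1) c(1) m_comm[of ?\<pi> "inv\<^bsub>K\<^esub> c \<odot>\<^bsub>A\<^esub> \<one>\<^bsub>A\<^esub>"] unfolding Units_def
    by (intro CollectI conjI bexI[of _ "inv\<^bsub>K\<^esub> c \<odot>\<^bsub>A\<^esub> \<one>\<^bsub>A\<^esub>"]) simp_all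
  then have "tate_ring A N ?\<pi>"
    by (intro tate_ring.intro M_cring tate_ring_axioms.intro norm_nonneg norm_eq_0_iff norm_minus
        norm_ultrametric norm_mult_le complete)
      (simp_all add: Npi mult norm_smult c)
  then show ?thesis by blast
qed

theorem corollary1p3:
  fixes K :: "('a, 'k) ring_scheme" and v :: "'a \<Rightarrow> real"
    and A :: "('a, 'b, 'm) module_scheme" and N :: "'b \<Rightarrow> real"
  assumes "nonarchimedean_banach_algebra K v A N"
    and "noetherian_ring A"
  shows "jacobson_ring A"
proof -
  obtain \<pi> where "tate_ring A N \<pi>"
    using nonarchimedean_banach_algebra.exists_tate_ring[OF assms(1)] by (rule exE)
  then show ?thesis using assms(2) by (rule tate_ring.noetherian_imp_jacobson)
qed

end
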